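(* Let $K$ be a weakly self-similar compact metric space. Then for the generic $f\in C(K)$, for every $y\in\operatorname{int} f(K)$, $$\dim_H f^{-1}(y)=\dim_{tH}K-1.$$
   Context: A compact metric space $K$ is weakly self-similar if for all $x\in K$ and $r>0$ there exist a compact set $K_{x,r}\subseteq B(x,r)$ and a bi-Lipschitz map $\phi_{x,r}\colon K_{x,r}\to K$. Here $B(x,r)=\{z\in K: d(x,z)\le r\}$, and a map is bi-Lipschitz if it is a bijection (in particular onto $K$) such that both it and its inverse are Lipschitz. $C(K)$ is the space of continuous functions $K\to\mathbb{R}$ with the supremum metric. "The generic $f\in C(K)$ has property $P$" means that the set of $f\in C(K)$ having $P$ is co-meager (its complement is a countable union of nowhere dense sets). $\operatorname{int}f(K)$ is the interior of $f(K)$ in $\mathbb{R}$. $\dim_H$ is Hausdorff dimension, with the convention $\dim_H\emptyset=-1$. Topological Hausdorff dimension: $\dim_{tH}\emptyset=-1$, and for a non-empty metric space $X$, $\dim_{tH}X=\inf\{d: X$ has a basis $\mathcal{U}$ of open sets such that $\dim_H\partial U\le d-1$ for every $U\in\mathcal{U}\}$. The value $\infty$ is allowed (and $\infty-1=\infty$). *)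

theory Defs
  imports "HOL-Analysis.Analysis"
begin

section \<open>Hausdorff dimension\<close>

text \<open>
  The \<open>s\<close>-th power of the diameter, with the convention that the empty set has value \<open>0\<close> and every
  non-empty set has value \<open>1\<close> for \<open>s = 0\<close> (whereas \<open>0 powr 0 = 0\<close>), so that the measure of
  exponent \<open>0\<close> is the counting measure.
\<close>
definition diam_powr :: "real \<Rightarrow> 'a::metric_space set \<Rightarrow> ennreal" where
  "diam_powr s U = (if U = {} then 0 else if s = 0 then 1 else ennreal (diameter U powr s))"

text \<open>
  Boundedness is required explicitly because \<^const>\<open>diameter\<close> is unspecified on unbounded sets.
\<close>
definition fine_covers :: "real \<Rightarrow> 'a::metric_space set \<Rightarrow> (nat \<Rightarrow> 'a set) set" where
  "fine_covers \<delta> A =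
     {U. A \<subseteq> (\<Union>i. U i) \<and> (\<forall>i. bounded (U i) \<and> diameter (U i) \<le> \<delta>)}"

definition hausdorff_measure_fine :: "real \<Rightarrow> real \<Rightarrow> 'a::metric_space set \<Rightarrow> ennreal" where
  "hausdorff_measure_fine s \<delta> A = (INF U\<in>fine_covers \<delta> A. \<Sum>i. diam_powr s (U i))"

text \<open>The limit as \<open>\<delta> \<rightarrow> 0\<close> is the supremum over \<open>\<delta> > 0\<close>, by monotonicity in \<open>\<delta>\<close>.\<close>
definition hausdorff_measure :: "real \<Rightarrow> 'a::metric_space set \<Rightarrow> ennreal" where
  "hausdorff_measure s A = (SUP \<delta>\<in>{0<..}. hausdorff_measure_fine s \<delta> A)"

definition hausdorff_dim :: "'a::metric_space set \<Rightarrow> ereal" where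
  "hausdorff_dim A =
     (if A = {} then -1 else (INF s\<in>{s. 0 \<le> s \<and> hausdorff_measure s A = 0}. ereal s))"


section \<open>Topological Hausdorff dimension\<close>

text \<open>
  A set \<open>X\<close> is regarded as a metric space in its own right: bases and boundaries are taken in the
  subspace topology of \<open>X\<close>. Letting \<open>d\<close> range over all of \<^typ>\<open>ereal\<close> is harmless: when \<open>X\<close> is
  non-empty a basis is non-empty, which forces \<open>d \<ge> 0\<close>, and \<open>d = \<infinity>\<close> is always admissible.
\<close>
definition top_hausdorff_dim :: "'a::metric_space set \<Rightarrow> ereal" where
  "top_hausdorff_dim X =
     (if X = {} then -1
      else Inf {d. \<exists>\<U>. openin (top_of_set X) = arbitrary union_of (\<lambda>U. U \<in> \<U>) \<and>
                       (\<forall>U\<in>\<U>. hausdorff_dim ((top_of_set X) frontier_of U) \<le> d - 1)})"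


section \<open>Weakly self-similar sets\<close>

definition bi_lipschitz_betw ::
    "('a::metric_space \<Rightarrow> 'b::metric_space) \<Rightarrow> 'a set \<Rightarrow> 'b set \<Rightarrow> bool" where
  "bi_lipschitz_betw \<phi> A B \<longleftrightarrow>
     bij_betw \<phi> A B \<and> (\<exists>L. L-lipschitz_on A \<phi>) \<and> (\<exists>L. L-lipschitz_on B (inv_into A \<phi>))"

definition weakly_self_similar :: "'a::metric_space set \<Rightarrow> bool" where
  "weakly_self_similar K \<longleftrightarrow>
     (\<forall>x\<in>K. \<forall>r>0. \<exists>K' \<phi>. compact K' \<and> K' \<subseteq> K \<inter> cball x r \<and> bi_lipschitz_betw \<phi> K' K)"


section \<open>Generic continuous functions\<close>

definition nowhere_dense_in :: "'a topology \<Rightarrow> 'a set \<Rightarrow> bool" where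
  "nowhere_dense_in X A \<longleftrightarrow> A \<subseteq> topspace X \<and> X interior_of (X closure_of A) = {}"

definition meagre_in :: "'a topology \<Rightarrow> 'a set \<Rightarrow> bool" where
  "meagre_in X A \<longleftrightarrow> (\<exists>N::nat \<Rightarrow> 'a set. (\<forall>n. nowhere_dense_in X (N n)) \<and> A = (\<Union>n. N n))"

definition comeagre_in :: "'a topology \<Rightarrow> 'a set \<Rightarrow> bool" where
  "comeagre_in X A \<longleftrightarrow> A \<subseteq> topspace X \<and> meagre_in X (topspace X - A)"

text \<open>
  \<open>C(K)\<close> with the supremum metric; elements are represented by functions that are
  \<^const>\<open>undefined\<close> outside \<open>K\<close>. For compact \<open>K\<close> the boundedness built into \<^const>\<open>cfunspace\<close> is
  automatic.
\<close>
definition C_space :: "'a::metric_space set \<Rightarrow> ('a \<Rightarrow> real) metric" where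
  "C_space K = cfunspace (top_of_set K) euclidean_metric"

definition generic_in_C :: "'a::metric_space set \<Rightarrow> (('a \<Rightarrow> real) \<Rightarrow> bool) \<Rightarrow> bool" where
  "generic_in_C K P \<longleftrightarrow> comeagre_in (mtopology_of (C_space K)) {f \<in> mspace (C_space K). P f}"

end

theory Submission
  imports Defs
begin

text \<open>
  Write \<open>d = dim\<^sub>t\<^sub>H K\<close>.

  Upper bound: for \<open>s > d - 1\<close>, \<open>s > 0\<close>, cover \<open>K\<close> by finitely many tiny open sets whose boundaries are
  \<open>s\<close>-null and enclose these boundaries in an open set \<open>V\<close> with a cover of small \<open>s\<close>-sum. Off \<open>V\<close> the atoms
  of the cover are clopen, so any function is close to some \<open>g\<close> that takes distinct constant values on
  them; every level set of every function near \<open>g\<close> then lies in \<open>V\<close> together with a single atom. If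
  \<open>d < 1\<close>, all boundaries are empty, so functions of finite range are dense and generic images have
  empty interior.

  Lower bound: for \<open>s < d - 1\<close> some \<open>x\<^sub>0\<close> has no small neighbourhoods with boundary of dimension at
  most \<open>s\<close>, so all functions near the distance to \<open>x\<^sub>0\<close> have level sets of dimension above \<open>s\<close> over a
  whole interval of heights. Weak self-similarity allows one to plant scaled copies of this situation in
  disjoint small parts of \<open>K\<close>, covering any interval \<open>[p, q]\<close> contained in the image.
\<close>

section \<open>Hausdorff null sets\<close>

lemma diameter_le_dist:
  fixes S :: "'a::metric_space set"
  assumes "0 \<le> d" "\<And>x y. x \<in> S \<Longrightarrow> y \<in> S \<Longrightarrow> dist x y \<le> d"
  shows "diameter S \<le> d"
  using assms by (auto simp: diameter_def intro!: cSUP_least)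

lemma bounded_dist_le:
  assumes "\<And>x y. x \<in> S \<Longrightarrow> y \<in> S \<Longrightarrow> dist x y \<le> d"
  shows "bounded S"
proof (cases "S = {}")
  case False
  then obtain a where "a \<in> S" by blast
  with assms show ?thesis unfolding bounded_def by blast
qed simp

lemma fine_covers_mono: "d \<le> e \<Longrightarrow> B \<subseteq> A \<Longrightarrow> fine_covers d A \<subseteq> fine_covers e B"
  unfolding fine_covers_def by (blast intro: order_trans)

text \<open>One parameter can bound both mesh and sum, because shrinking \<open>e\<close> tightens
  both at once. This replaces the nested supremum and infimum in all later arguments about null
  sets.\<close>

lemma hausdorff_measure_eq_0_iff:
  "hausdorff_measure s A = 0 \<longleftrightarrow>
     (\<forall>e>0. \<exists>U\<in>fine_covers e A. (\<Sum>i. diam_powr s (U i)) \<le> ennreal e)"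
proof safe
  fix e :: real assume "hausdorff_measure s A = 0" "e > 0"
  then have "hausdorff_measure_fine s e A \<le> 0"
    unfolding hausdorff_measure_def by (metis SUP_upper greaterThan_iff)
  with \<open>e > 0\<close> have "hausdorff_measure_fine s e A < ennreal e" by simp
  then show "\<exists>U\<in>fine_covers e A. (\<Sum>i. diam_powr s (U i)) \<le> ennreal e"
    unfolding hausdorff_measure_fine_def INF_less_iff by (auto intro: less_imp_le)
next
  assume *: "\<forall>e>0. \<exists>U\<in>fine_covers e A. (\<Sum>i. diam_powr s (U i)) \<le> ennreal e"
  have "hausdorff_measure_fine s d A \<le> 0" if "d > 0" for d
  proof (rule ennreal_le_epsilon)
    fix e :: real assume "e > 0"
    then obtain U where U: "U \<in> fine_covers (min d e) A"
      "(\<Sum>i. diam_powr s (U i)) \<le> ennreal (min d e)"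
      using * \<open>d > 0\<close> by (metis min_less_iff_conj)
    have "U \<in> fine_covers d A"
      using U(1) fine_covers_mono[of "min d e" d A A] by auto
    moreover have "ennreal (min d e) \<le> ennreal e" by (simp add: ennreal_leI)
    ultimately show "hausdorff_measure_fine s d A \<le> 0 + ennreal e"
      unfolding hausdorff_measure_fine_def using U(2)
      by (metis INF_lower2 add_0 order_trans)
  qed
  then show "hausdorff_measure s A = 0"
    unfolding hausdorff_measure_def by (auto intro!: antisym SUP_least)
qed

lemma hausdorff_null_subset:
  "hausdorff_measure s A = 0 \<Longrightarrow> B \<subseteq> A \<Longrightarrow> hausdorff_measure s B = 0"
  unfolding hausdorff_measure_eq_0_iff using fine_covers_mono by blast

lemma diam_powr_le:
  assumes "0 < s" "bounded U" "diameter U \<le> d"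
  shows "diam_powr s U \<le> ennreal (d powr s)"
  using assms diameter_ge_0[OF assms(2)] by (auto simp: diam_powr_def intro!: ennreal_leI powr_mono2)

lemma hausdorff_null_mono_exponent:
  assumes "0 \<le> s" "s < t" "hausdorff_measure s A = 0"
  shows "hausdorff_measure t A = 0"
  unfolding hausdorff_measure_eq_0_iff
proof safe
  fix e :: real assume "e > 0"
  then obtain U where U: "U \<in> fine_covers (min 1 e) A"
    "(\<Sum>i. diam_powr s (U i)) \<le> ennreal (min 1 e)"
    using assms unfolding hausdorff_measure_eq_0_iff
    by (metis min_less_iff_conj zero_less_one)
  have "diam_powr t (U i) \<le> diam_powr s (U i)" for i
  proof -
    have b: "bounded (U i)" "diameter (U i) \<le> 1" using U(1) by (auto simp: fine_covers_def)
    \<comment> \<open>The mesh is at most 1, so powers decrease in the exponent. The second bound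
      serves \<open>s = 0\<close>, where \<open>diam_powr\<close> is 1 by convention.\<close>
    then have "diameter (U i) powr t \<le> diameter (U i) powr s" "diameter (U i) powr t \<le> 1"
      using assms diameter_ge_0[of "U i"] by (auto intro: powr_mono' powr_le1)
    then show ?thesis
      using assms by (auto simp: diam_powr_def intro!: ennreal_leI simp flip: ennreal_1)
  qed
  then have "(\<Sum>i. diam_powr t (U i)) \<le> (\<Sum>i. diam_powr s (U i))"
    by (intro suminf_le) auto
  also have "\<dots> \<le> ennreal e" using U(2) by (rule order_trans) (simp add: ennreal_leI)
  finally show "\<exists>U\<in>fine_covers e A. (\<Sum>i. diam_powr t (U i)) \<le> ennreal e"
    using U(1) fine_covers_mono[of "min 1 e" e A A] by auto
qed

text \<open>The \<open>n\<close>-th set gets mesh and budget \<open>e * (1/2) ^ Suc n\<close>. The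
  budgets add up to \<open>e\<close>, and \<open>prod_decode\<close> merges the double sequence of
  covering sets into one.\<close>

lemma hausdorff_null_UN:
  assumes "\<And>n::nat. hausdorff_measure s (A n) = 0"
  shows "hausdorff_measure s (\<Union>n. A n) = 0"
  unfolding hausdorff_measure_eq_0_iff
proof safe
  fix e :: real assume e: "e > 0"
  have "\<exists>U\<in>fine_covers (e * (1/2) ^ Suc n) (A n).
          (\<Sum>i. diam_powr s (U i)) \<le> ennreal (e * (1/2) ^ Suc n)" for n
    using assms[of n] e unfolding hausdorff_measure_eq_0_iff by simp
  then obtain U where U: "\<And>n. U n \<in> fine_covers (e * (1/2) ^ Suc n) (A n)"
    "\<And>n. (\<Sum>i. diam_powr s (U n i)) \<le> ennreal (e * (1/2) ^ Suc n)"
    by metis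
  define W where "W = (\<lambda>i. case_prod U (prod_decode i))"
  have "(\<Sum>i. diam_powr s (W i)) = (\<Sum>n. \<Sum>i. diam_powr s (U n i))"
    using suminf_ennreal_2dimen[of "\<lambda>n. \<Sum>i. diam_powr s (U n i)" "\<lambda>p. diam_powr s (case_prod U p)"]
    by (simp add: W_def)
  also have "\<dots> \<le> (\<Sum>n. ennreal (e * (1/2) ^ Suc n))"
    by (intro suminf_le U) auto
  also have "\<dots> = ennreal e"
    using sums_mult[OF power_half_series, of e] e by (intro suminf_ennreal_eq) auto
  finally have sum: "(\<Sum>i. diam_powr s (W i)) \<le> ennreal e" .
  have "W \<in> fine_covers e (\<Union>n. A n)"
    unfolding fine_covers_def
  proof (intro CollectI conjI allI subsetI)
    fix x assume "x \<in> (\<Union>n. A n)"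
    then obtain n i where "x \<in> U n i" using U(1) unfolding fine_covers_def by blast
    then have "x \<in> W (prod_encode (n, i))" by (simp add: W_def)
    then show "x \<in> (\<Union>i. W i)" by blast
  next
    fix i
    obtain n j where p: "prod_decode i = (n, j)" by fastforce
    then show "bounded (W i)" using U(1)[of n] by (simp add: W_def fine_covers_def)
    have "diameter (W i) \<le> e * (1/2) ^ Suc n"
      using U(1)[of n] p by (simp add: W_def fine_covers_def)
    also have "\<dots> \<le> e * 1" using e by (intro mult_left_mono power_le_one) auto
    finally show "diameter (W i) \<le> e" by simp
  qed
  with sum show "\<exists>U\<in>fine_covers e (\<Union>n. A n). (\<Sum>i. diam_powr s (U i)) \<le> ennreal e" by blast
qed

lemma hausdorff_null_empty: "hausdorff_measure s {} = 0"
  unfolding hausdorff_measure_eq_0_iff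
  by (auto intro!: bexI[of _ "\<lambda>_. {}"] simp: fine_covers_def diam_powr_def)

lemma hausdorff_null_Union:
  assumes "countable \<A>" "\<And>A. A \<in> \<A> \<Longrightarrow> hausdorff_measure s A = 0"
  shows "hausdorff_measure s (\<Union>\<A>) = 0"
proof (cases "\<A> = {}")
  case False
  then have "\<Union>\<A> = (\<Union>n. from_nat_into \<A> n)"
    using assms(1) by (metis range_from_nat_into)
  moreover have "hausdorff_measure s (\<Union>n. from_nat_into \<A> n) = 0"
    using assms(2) False by (intro hausdorff_null_UN) (simp add: from_nat_into)
  ultimately show ?thesis by metis
qed (simp add: hausdorff_null_empty)

text \<open>Each set of a cover is thickened to an open one, by a radius so small that the
  \<open>i\<close>-th power of the diameter grows by at most \<open>e/2 * (1/2) ^ Suc i\<close>. The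
  union of the new sets will be the open neighbourhood of the boundaries.\<close>

lemma ex_open_cover_hausdorff_null:
  assumes "0 < s" "hausdorff_measure s A = 0" "e > 0"
  shows "\<exists>V\<in>fine_covers e A. (\<forall>i. open (V i)) \<and> (\<Sum>i. diam_powr s (V i)) \<le> ennreal e"
proof -
  obtain U where U: "U \<in> fine_covers (e/2) A" "(\<Sum>i. diam_powr s (U i)) \<le> ennreal (e/2)"
    using assms unfolding hausdorff_measure_eq_0_iff by (meson half_gt_zero)
  have bU: "bounded (U i)" and dU: "diameter (U i) \<le> e/2" for i
    using U(1) by (auto simp: fine_covers_def)
  have "\<exists>r>0. 2 * r \<le> e/2 \<and>
      (diameter (U i) + 2*r) powr s \<le> diameter (U i) powr s + e/2 * (1/2) ^ Suc i" for i
  proof -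
    let ?D = "diameter (U i)"
    \<comment> \<open>Since \<open>s > 0\<close>, the power is continuous even where its base
      vanishes, so singletons in the cover can be thickened too.\<close>
    have c: "continuous (at_right 0) (\<lambda>r. (?D + 2*r) powr s)"
      using diameter_ge_0[OF bU, of i] assms(1)
      by (intro continuous_on_imp_continuous_within[of "{0..}"] continuous_on_powr' continuous_intros) auto
    have "((\<lambda>r. (?D + 2*r) powr s) \<longlongrightarrow> ?D powr s) (at_right 0)"
      using c by (simp add: continuous_within)
    then have "\<forall>\<^sub>F r in at_right 0. (?D + 2*r) powr s < ?D powr s + e/2 * (1/2) ^ Suc i"
      using \<open>e > 0\<close> by (intro order_tendstoD(2)[where y = "?D powr s"]) auto
    moreover have "\<forall>\<^sub>F r in at_right 0. r \<in> {0<..<e/4}"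
      using \<open>e > 0\<close> by (intro eventually_at_right_real) auto
    ultimately have "\<forall>\<^sub>F r in at_right 0. r > 0 \<and> r < e/4 \<and>
        (?D + 2*r) powr s < ?D powr s + e/2 * (1/2) ^ Suc i"
      by eventually_elim auto
    from eventually_happens[OF this] show ?thesis by (force intro: less_imp_le)
  qed
  then obtain r where r: "\<And>i. r i > 0" "\<And>i. 2 * r i \<le> e/2"
    "\<And>i. (diameter (U i) + 2 * r i) powr s \<le> diameter (U i) powr s + e/2 * (1/2) ^ Suc i"
    by metis
  define V where "V = (\<lambda>i. \<Union>x\<in>U i. ball x (r i))"
  have dist: "dist x y \<le> diameter (U i) + 2 * r i" if xy: "x \<in> V i" "y \<in> V i" for x y i
  proof -
    obtain u v where uv: "u \<in> U i" "v \<in> U i" "dist u x < r i" "dist v y < r i"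
      using xy by (auto simp: V_def)
    have "dist u v \<le> diameter (U i)" using bU uv by (intro diameter_bounded_bound)
    then show ?thesis
      using uv dist_triangle[of x y u] dist_triangle[of u y v] by (simp add: dist_commute)
  qed
  have bV: "bounded (V i)" for i using dist by (rule bounded_dist_le)
  have dV: "diameter (V i) \<le> diameter (U i) + 2 * r i" for i
    using dist diameter_ge_0[OF bU] r(1) by (intro diameter_le_dist) (auto simp: less_imp_le)
  have "diam_powr s (V i) \<le> diam_powr s (U i) + ennreal (e/2 * (1/2) ^ Suc i)" for i
  proof (cases "U i = {}")
    case False
    have "diam_powr s (V i) \<le> ennreal ((diameter (U i) + 2 * r i) powr s)"
      using assms(1) bV dV by (rule diam_powr_le)
    also have "\<dots> \<le> ennreal (diameter (U i) powr s + e/2 * (1/2) ^ Suc i)"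
      by (intro ennreal_leI r)
    finally show ?thesis using False assms by (simp add: diam_powr_def ennreal_plus)
  qed (simp add: V_def diam_powr_def)
  then have "(\<Sum>i. diam_powr s (V i)) \<le> (\<Sum>i. diam_powr s (U i) + ennreal (e/2 * (1/2) ^ Suc i))"
    by (intro suminf_le) auto
  also have "\<dots> = (\<Sum>i. diam_powr s (U i)) + (\<Sum>i. ennreal (e/2 * (1/2) ^ Suc i))"
    by (rule suminf_add[symmetric]) auto
  also have "(\<Sum>i. ennreal (e/2 * (1/2) ^ Suc i)) = ennreal (e/2)"
    using sums_mult[OF power_half_series, of "e/2"] \<open>e > 0\<close> by (intro suminf_ennreal_eq) auto
  also have "(\<Sum>i. diam_powr s (U i)) + ennreal (e/2) \<le> ennreal (e/2) + ennreal (e/2)"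
    using U(2) by (rule add_right_mono)
  also have "\<dots> = ennreal e" using \<open>e > 0\<close> by (simp flip: ennreal_plus)
  finally have "(\<Sum>i. diam_powr s (V i)) \<le> ennreal e" .
  moreover have "V \<in> fine_covers e A"
  proof -
    have "U i \<subseteq> V i" for i using r(1) by (force simp: V_def)
    moreover have "diameter (V i) \<le> e" for i using dV[of i] dU[of i] r(2)[of i] by linarith
    ultimately show ?thesis using U(1) bV by (fastforce simp: fine_covers_def)
  qed
  moreover have "open (V i)" for i by (auto simp: V_def)
  ultimately show ?thesis by blast
qed

text \<open>Used to prepend the part of a level set that lies outside the open neighbourhood of the
  boundaries to the sequence covering that neighbourhood.\<close>

lemma fine_covers_case_nat:
  assumes "V \<in> fine_covers e B" "bounded C" "diameter C \<le> e"
  shows "case_nat C V \<in> fine_covers e (C \<union> B)"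
  unfolding fine_covers_def
proof (intro CollectI conjI allI)
  show "C \<union> B \<subseteq> (\<Union>i. case_nat C V i)"
  proof
    fix x assume "x \<in> C \<union> B"
    then consider "x \<in> case_nat C V 0" | i where "x \<in> case_nat C V (Suc i)"
      using assms(1) by (auto simp: fine_covers_def)
    then show "x \<in> (\<Union>i. case_nat C V i)" by cases (rule UN_I, rule UNIV_I, assumption)+
  qed
  fix i show "bounded (case_nat C V i)" "diameter (case_nat C V i) \<le> e"
    using assms by (simp_all add: fine_covers_def split: nat.split)
qed

lemma suminf_diam_powr_case_nat:
  "(\<Sum>i. diam_powr s (case_nat C V i)) = diam_powr s C + (\<Sum>i. diam_powr s (V i))"
proof -
  have "(\<lambda>i. diam_powr s (V i)) sums (\<Sum>i. diam_powr s (V i))" by (rule summable_sums) simp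
  then have "(\<lambda>i. diam_powr s (case_nat C V (Suc i))) sums (\<Sum>i. diam_powr s (V i))" by simp
  from sums_unique[OF sums_Suc[OF this]] show ?thesis by (simp add: add.commute)
qed

lemma hausdorff_null_lipschitz_image:
  fixes f :: "'a::metric_space \<Rightarrow> 'b::metric_space"
  assumes "0 \<le> s" "L-lipschitz_on A f" "hausdorff_measure s A = 0"
  shows "hausdorff_measure s (f ` A) = 0"
  unfolding hausdorff_measure_eq_0_iff
proof safe
  fix e :: real assume "e > 0"
  \<comment> \<open>Taking the maximum with 1 allows division by \<open>M\<close> and
    \<open>c\<close>, also when \<open>L = 0\<close>. Diameters grow by a factor of at most
    \<open>M\<close>, and \<open>s\<close>-sums by at most \<open>c\<close>.\<close>
  define M where "M = max L 1"
  define c where "c = M powr s"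
  have M: "M \<ge> 1" "L \<le> M" and c: "c \<ge> 1" using assms(1) by (auto simp: M_def c_def ge_one_powr_ge_zero)
  define d where "d = min (e / M) (e / c)"
  have d: "d > 0" "M * d \<le> e" "c * d \<le> e"
    using \<open>e > 0\<close> M c by (auto simp: d_def min_def field_simps)
  obtain U where U: "U \<in> fine_covers d A" "(\<Sum>i. diam_powr s (U i)) \<le> ennreal d"
    using assms(3) d unfolding hausdorff_measure_eq_0_iff by blast
  define V where "V = (\<lambda>i. f ` (U i \<inter> A))"
  have dist: "dist x y \<le> M * diameter (U i)" if "x \<in> V i" "y \<in> V i" for x y i
  proof -
    obtain u v where uv: "u \<in> U i \<inter> A" "v \<in> U i \<inter> A" "x = f u" "y = f v"
      using \<open>x \<in> V i\<close> \<open>y \<in> V i\<close> by (auto simp: V_def)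
    have "dist x y \<le> L * dist u v" using uv assms(2) by (auto dest: lipschitz_onD)
    also have "\<dots> \<le> M * dist u v" using M by (intro mult_right_mono) auto
    also have "\<dots> \<le> M * diameter (U i)"
      using U(1) uv M by (intro mult_left_mono diameter_bounded_bound) (auto simp: fine_covers_def)
    finally show ?thesis .
  qed
  have D0: "0 \<le> diameter (U i)" for i using U(1) by (auto simp: fine_covers_def intro: diameter_ge_0)
  have bV: "bounded (V i)" for i using dist by (rule bounded_dist_le)
  have dV: "diameter (V i) \<le> M * diameter (U i)" for i
    using dist D0 M by (intro diameter_le_dist) auto
  have "diam_powr s (V i) \<le> ennreal c * diam_powr s (U i)" for i
  proof (cases "U i = {} \<or> V i = {}")
    case False
    have "diameter (V i) powr s \<le> (M * diameter (U i)) powr s"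
      using assms(1) dV bV by (intro powr_mono2 diameter_ge_0)
    also have "\<dots> = c * diameter (U i) powr s" using M D0 by (simp add: powr_mult c_def)
    finally have "ennreal (diameter (V i) powr s) \<le> ennreal c * ennreal (diameter (U i) powr s)"
      using c by (simp flip: ennreal_mult add: ennreal_leI)
    then show ?thesis using False c by (auto simp: diam_powr_def c_def)
  qed (auto simp: diam_powr_def V_def)
  then have "(\<Sum>i. diam_powr s (V i)) \<le> (\<Sum>i. ennreal c * diam_powr s (U i))"
    by (intro suminf_le) auto
  also have "\<dots> = ennreal c * (\<Sum>i. diam_powr s (U i))" by simp
  also have "\<dots> \<le> ennreal c * ennreal d" using U(2) by (rule mult_left_mono) simp
  also have "\<dots> \<le> ennreal e" using c d by (simp flip: ennreal_mult add: ennreal_leI)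
  finally have "(\<Sum>i. diam_powr s (V i)) \<le> ennreal e" .
  moreover have "V \<in> fine_covers e (f ` A)"
    unfolding fine_covers_def
  proof (intro CollectI conjI allI bV)
    show "f ` A \<subseteq> (\<Union>i. V i)" using U(1) unfolding V_def fine_covers_def by blast
    fix i
    have "M * diameter (U i) \<le> M * d" using U(1) M by (intro mult_left_mono) (auto simp: fine_covers_def)
    then show "diameter (V i) \<le> e" using dV[of i] d by linarith
  qed
  ultimately show "\<exists>U\<in>fine_covers e (f ` A). (\<Sum>i. diam_powr s (U i)) \<le> ennreal e" by blast
qed


section \<open>Hausdorff dimension\<close>

lemma hausdorff_dim_nonneg: "A \<noteq> {} \<Longrightarrow> 0 \<le> hausdorff_dim A"
  unfolding hausdorff_dim_def by (auto intro!: INF_greatest)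

lemma hausdorff_dim_less_imp_null:
  assumes "hausdorff_dim A < ereal s"
  shows "hausdorff_measure s A = 0"
proof (cases "A = {}")
  case False
  then obtain t where "0 \<le> t" "hausdorff_measure t A = 0" "t < s"
    using assms by (auto simp: hausdorff_dim_def INF_less_iff)
  then show ?thesis by (rule_tac hausdorff_null_mono_exponent)
qed (simp add: hausdorff_null_empty)

lemma hausdorff_dim_le_null:
  assumes "0 \<le> s" "hausdorff_measure s A = 0"
  shows "hausdorff_dim A \<le> ereal s"
proof (cases "A = {}")
  case True
  have "(-1::ereal) \<le> 0" by simp
  also have "0 \<le> ereal s" using assms(1) by simp
  finally show ?thesis using True by (simp add: hausdorff_dim_def)
qed (use assms in \<open>auto simp: hausdorff_dim_def intro: INF_lower2\<close>)

lemma hausdorff_dim_lipschitz_image: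
  assumes "L-lipschitz_on A f"
  shows "hausdorff_dim (f ` A) \<le> hausdorff_dim A"
  using hausdorff_null_lipschitz_image[OF _ assms]
  by (auto simp: hausdorff_dim_def intro!: INF_superset_mono)

lemma hausdorff_dim_mono:
  assumes "A \<subseteq> B" shows "hausdorff_dim A \<le> hausdorff_dim B"
proof (cases "A = {} \<and> B \<noteq> {}")
  case True
  have "hausdorff_dim A \<le> 0" using True by (simp add: hausdorff_dim_def)
  also have "0 \<le> hausdorff_dim B" using True by (simp add: hausdorff_dim_nonneg)
  finally show ?thesis .
next
  case False
  then show ?thesis using assms hausdorff_null_subset[OF _ assms]
    by (auto simp: hausdorff_dim_def intro!: INF_superset_mono)
qed


section \<open>A criterion for genericity\<close>

lemma mtopology_of_euclidean_metric: "mtopology_of euclidean_metric = (euclidean :: 'a::metric_space topology)"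
  by (simp add: mtopology_of_def)

lemma mspace_C_space:
  assumes "compact K"
  shows "mspace (C_space K) = {f. f \<in> extensional K \<and> continuous_on K f}"
proof -
  have "compactin (top_of_set K) (topspace (top_of_set K))"
    using assms by (simp add: compactin_subtopology)
  from compactin_mspace_cfunspace[OF this, of euclidean_metric] show ?thesis
    by (auto simp: C_space_def mtopology_of_euclidean_metric)
qed

lemma mdist_C_space_le:
  assumes "0 \<le> e" "\<And>x. x \<in> K \<Longrightarrow> \<bar>f x - g x\<bar> \<le> e"
  shows "mdist (C_space K) f g \<le> e"
  unfolding C_space_def using assms by (intro mdist_cfunspace_le) (auto simp: dist_real_def)

lemma mdist_C_space_leD:
  assumes "f \<in> mspace (C_space K)" "g \<in> mspace (C_space K)" "mdist (C_space K) f g \<le> e" "x \<in> K"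
  shows "\<bar>f x - g x\<bar> \<le> e"
  using mdist_cfunspace_imp_mdist_le[of f "top_of_set K" euclidean_metric g e x] assms
  by (simp add: C_space_def dist_real_def)

text \<open>The hypothesis \<open>dense\<close> says that every ball of \<open>C(K)\<close> contains
  a smaller ball on which \<open>Q i\<close> holds, so the failures of each \<open>Q i\<close> are
  nowhere dense. Countably many such conditions may thus be imposed at once.\<close>

lemma generic_in_C_I:
  fixes K :: "'a::metric_space set"
  assumes K: "compact K" and I: "countable I"
    and dense: "\<And>i f e. i \<in> I \<Longrightarrow> continuous_on K f \<Longrightarrow> e > 0 \<Longrightarrow>
      \<exists>g r. continuous_on K g \<and> (\<forall>x\<in>K. \<bar>g x - f x\<bar> \<le> e) \<and> r > 0 \<and>
        (\<forall>h. continuous_on K h \<longrightarrow> (\<forall>x\<in>K. \<bar>h x - g x\<bar> \<le> r) \<longrightarrow> Q i h)"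
    and P: "\<And>h. continuous_on K h \<Longrightarrow> \<forall>i\<in>I. Q i h \<Longrightarrow> P h"
  shows "generic_in_C K P"
proof -
  let ?M = "mspace (C_space K)" and ?d = "mdist (C_space K)" and ?T = "mtopology_of (C_space K)"
  interpret Metric_space ?M ?d by (rule Metric_space_mspace_mdist)
  have T: "?T = mtopology" by (simp add: mtopology_of_def)
  note M = mspace_C_space[OF K]
  \<comment> \<open>\<open>meagre_in\<close> asks for an equality with a union. The conjunct
    \<open>\<not> P h\<close> keeps the sets \<open>N i\<close> inside the exceptional set, so that
    their union is exactly that set.\<close>
  define N where "N = (\<lambda>i. {h \<in> ?M. \<not> Q i h \<and> \<not> P h})"
  have nd: "nowhere_dense_in ?T (N i)" if i: "i \<in> I" for i
    unfolding nowhere_dense_in_def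
  proof
    show "N i \<subseteq> topspace ?T" by (auto simp: N_def)
    have "f \<notin> mtopology interior_of (mtopology closure_of N i)" for f
    proof
      assume "f \<in> mtopology interior_of (mtopology closure_of N i)"
      then obtain e where e: "f \<in> ?M" "e > 0" "mball f e \<subseteq> mtopology closure_of N i"
        unfolding metric_interior_of by blast
      then obtain g r where g: "continuous_on K g" "\<And>x. x \<in> K \<Longrightarrow> \<bar>g x - f x\<bar> \<le> e/2" "r > 0"
        "\<And>h. continuous_on K h \<Longrightarrow> (\<forall>x\<in>K. \<bar>h x - g x\<bar> \<le> r) \<Longrightarrow> Q i h"
        using dense[OF i, of f "e/2"] M by auto
      \<comment> \<open>Elements of \<open>C(K)\<close> are \<open>undefined\<close> off
        \<open>K\<close>, so \<open>g\<close> has to be restricted to become one.\<close>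
      define g' where "g' = restrict g K"
      have g': "g' \<in> ?M" using g(1) M by (auto simp: g'_def cong: continuous_on_cong)
      have "?d f g' \<le> e/2"
        using e g(2) by (intro mdist_C_space_le) (auto simp: g'_def abs_minus_commute)
      then have "g' \<in> mball f e" using e g' by auto
      then have "g' \<in> mtopology closure_of N i" using e by blast
      then obtain h where h: "h \<in> N i" "h \<in> mball g' r"
        using g(3) unfolding metric_closure_of by blast
      have "\<bar>h x - g x\<bar> \<le> r" if "x \<in> K" for x
        using mdist_C_space_leD[of g' K h r x] h that
        by (auto simp: g'_def abs_minus_commute)
      then have "Q i h" using h M by (intro g(4)) (auto simp: N_def)
      then show False using h by (simp add: N_def)
    qed
    then show "?T interior_of (?T closure_of N i) = {}" unfolding T by blast
  qed
  have "meagre_in ?T (topspace ?T - {f \<in> ?M. P f})"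
  proof (cases "I = {}")
    case True
    then have "topspace ?T - {f \<in> ?M. P f} = {}" using P M by auto
    moreover have "nowhere_dense_in ?T {}" by (simp add: nowhere_dense_in_def)
    ultimately show ?thesis unfolding meagre_in_def by (intro exI[of _ "\<lambda>_. {}"]) auto
  next
    case False
    have "topspace ?T - {f \<in> ?M. P f} = (\<Union>i\<in>I. N i)" using P M by (auto simp: N_def)
    also have "\<dots> = (\<Union>n. N (from_nat_into I n))"
      using range_from_nat_into[OF False I] by (metis image_image)
    finally show ?thesis
      unfolding meagre_in_def using nd False by (metis from_nat_into)
  qed
  then show ?thesis by (auto simp: generic_in_C_def comeagre_in_def)
qed


section \<open>Extension and approximation of continuous functions\<close>

text \<open>Tietze's theorem is applied to the difference \<open>u - f\<close>, with values in
  \<open>{-e..e}\<close>. Adding the extension back to \<open>f\<close> gives a small perturbation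
  with prescribed values on \<open>S\<close>.\<close>

lemma extend_approximation:
  fixes f u :: "'a::metric_space \<Rightarrow> real"
  assumes "closedin (top_of_set K) S" "continuous_on K f" "continuous_on S u" "0 \<le> e"
    and "\<And>x. x \<in> S \<Longrightarrow> \<bar>u x - f x\<bar> \<le> e"
  shows "\<exists>g. continuous_on K g \<and> (\<forall>x\<in>S. g x = u x) \<and> (\<forall>x\<in>K. \<bar>g x - f x\<bar> \<le> e)"
proof -
  have SK: "S \<subseteq> K" using assms(1) by (rule closedin_imp_subset)
  have ns: "normal_space (top_of_set K)"
    by (intro metrizable_imp_normal_space metrizable_space_subtopology metrizable_space_euclidean)
  have "continuous_on S (\<lambda>x. u x - f x)"
    using assms SK by (intro continuous_intros) (auto intro: continuous_on_subset)
  then have cm: "continuous_map (subtopology (top_of_set K) S) euclideanreal (\<lambda>x. u x - f x)"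
    using SK by (simp add: subtopology_subtopology Int_absorb1)
  have im: "(\<lambda>x. u x - f x) ` S \<subseteq> {-e..e}" using assms(5) by (fastforce simp: abs_le_iff)
  have le: "-e \<le> e" using assms by simp
  obtain v where v: "continuous_map (top_of_set K) euclideanreal v"
    "\<And>x. x \<in> S \<Longrightarrow> v x = u x - f x" "v ` topspace (top_of_set K) \<subseteq> {-e..e}"
    by (rule Tietze_extension_closed_real_interval[OF ns assms(1) cm im le]) blast
  have "\<bar>v x\<bar> \<le> e" if "x \<in> K" for x using v(3) that by (force simp: abs_le_iff)
  then show ?thesis using v(1,2) assms(2)
    by (intro exI[of _ "\<lambda>x. f x + v x"]) (auto intro!: continuous_intros)
qed

text \<open>The image is compact, so an omitted value has positive distance from it.\<close>

lemma not_in_image_open: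
  fixes g :: "'a::metric_space \<Rightarrow> real"
  assumes "compact K" "continuous_on K g" "y \<notin> g ` K"
  shows "\<exists>r>0. \<forall>h. (\<forall>x\<in>K. \<bar>h x - g x\<bar> \<le> r) \<longrightarrow> y \<notin> h ` K"
proof -
  have "closed (g ` K)" using assms by (simp add: compact_continuous_image compact_imp_closed)
  then obtain r where r: "r > 0" "\<And>z. z \<in> g ` K \<Longrightarrow> r \<le> dist y z"
    using separate_point_closed assms(3) by metis
  have "y \<notin> h ` K" if h: "\<forall>x\<in>K. \<bar>h x - g x\<bar> \<le> r/2" for h
  proof
    assume "y \<in> h ` K"
    then obtain x where "x \<in> K" "y = h x" by blast
    then show False using h r(1) r(2)[of "g x"] by (force simp: dist_real_def)
  qed
  then show ?thesis using r(1) by (intro exI[of _ "r/2"]) auto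
qed

lemma finite_separated:
  fixes A :: "'a::metric_space set"
  assumes "finite A"
  shows "\<exists>r>0. \<forall>a\<in>A. \<forall>b\<in>A. a \<noteq> b \<longrightarrow> 2 * r < dist a b"
proof -
  \<comment> \<open>The extra element 1 keeps the minimum defined when \<open>A\<close> has at most
    one point.\<close>
  define D where "D = insert 1 ((\<lambda>(a, b). dist a b) ` {(a, b) \<in> A \<times> A. a \<noteq> b})"
  have "finite {(a, b) \<in> A \<times> A. a \<noteq> b}" by (rule finite_subset[of _ "A \<times> A"]) (use assms in auto)
  then have D: "finite D" "D \<noteq> {}" by (auto simp: D_def)
  then have pos: "0 < Min D" by (auto simp: D_def)
  have "2 * (Min D / 3) < dist a b" if "a \<in> A" "b \<in> A" "a \<noteq> b" for a b
  proof -
    have "dist a b \<in> D" unfolding D_def using that by force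
    then have "Min D \<le> dist a b" using D by simp
    then show ?thesis using pos by simp
  qed
  then show ?thesis using pos by (intro exI[of _ "Min D / 3"]) auto
qed

text \<open>By induction: an interval is infinite, so it has room for a value not yet taken. This
  separates the constants put on different atoms.\<close>

lemma finite_injective_approximation:
  fixes b :: "'b \<Rightarrow> real"
  assumes "finite A" "e > 0"
  shows "\<exists>c. inj_on c A \<and> (\<forall>a\<in>A. \<bar>c a - b a\<bar> \<le> e)"
  using assms(1)
proof induction
  case (insert a A)
  then obtain c where c: "inj_on c A" "\<forall>a\<in>A. \<bar>c a - b a\<bar> \<le> e" by blast
  have "infinite ({b a - e..b a + e} - c ` A)"
    using insert.hyps assms(2) by (intro Diff_infinite_finite) (auto simp: infinite_Icc_iff)
  then obtain z where "z \<in> {b a - e..b a + e}" "z \<notin> c ` A"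
    by (metis DiffE ex_in_conv finite.emptyI)
  then show ?case using c insert.hyps
    by (intro exI[of _ "c(a := z)"]) (auto simp: inj_on_def abs_le_iff)
qed auto

text \<open>
  Off a neighbourhood \<open>V\<close> of the boundaries, each \<open>U \<in> \<U>\<close> is clopen, so the atoms of \<open>\<U>\<close> are
  clopen and a function constant on each of them is continuous.
\<close>
lemma approximation_constant_on_atoms:
  fixes f :: "'a::metric_space \<Rightarrow> real"
  assumes fin: "finite \<U>" and cover: "K \<subseteq> \<Union>\<U>"
    and op: "\<And>U. U \<in> \<U> \<Longrightarrow> openin (top_of_set K) U"
    and V: "open V" "\<And>U. U \<in> \<U> \<Longrightarrow> (top_of_set K) frontier_of U \<subseteq> V"
    and f: "continuous_on K f" and e: "e > 0"
    and osc: "\<And>U x y. U \<in> \<U> \<Longrightarrow> x \<in> U \<Longrightarrow> y \<in> U \<Longrightarrow> \<bar>f x - f y\<bar> \<le> e"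
  shows "\<exists>g c. continuous_on K g \<and> (\<forall>x\<in>K. \<bar>g x - f x\<bar> \<le> 2 * e) \<and> inj_on c (Pow \<U>) \<and>
    (\<forall>x\<in>K - V. g x = c {U \<in> \<U>. x \<in> U})"
proof -
  \<comment> \<open>The atoms are the fibres of \<open>lab\<close>, and \<open>b\<close> samples
    \<open>f\<close> at one point of each. On labels without a point in \<open>K - V\<close> the
    choice is arbitrary, and the estimates use \<open>b\<close> only on labels of actual
    points.\<close>
  define lab where "lab = (\<lambda>x. {U \<in> \<U>. x \<in> U})"
  define b where "b = (\<lambda>L. f (SOME x. x \<in> K - V \<and> lab x = L))"
  obtain c where c: "inj_on c (Pow \<U>)" "\<And>L. L \<in> Pow \<U> \<Longrightarrow> \<bar>c L - b L\<bar> \<le> e"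
    using finite_injective_approximation[of "Pow \<U>" e b] fin e by auto
  have locU: "\<forall>\<^sub>F y in at x within (K - V). y \<in> U \<longleftrightarrow> x \<in> U" if x: "x \<in> K - V" and U: "U \<in> \<U>" for x U
  proof -
    let ?X = "top_of_set K"
    \<comment> \<open>A point off \<open>V\<close> is not on the boundary of \<open>U\<close>, so it
      lies in \<open>U\<close> or outside its closure. Both sets are open in \<open>K\<close>, and
      \<open>?C\<close> is the one that contains \<open>x\<close>.\<close>
    let ?C = "if x \<in> U then U else K - ?X closure_of U"
    have UK: "U \<subseteq> K" using op[OF U] openin_imp_subset by blast
    have fr: "?X frontier_of U = ?X closure_of U - U"
      using op[OF U] by (simp add: frontier_of_def interior_of_openin)
    have "openin ?X ?C"
      using op[OF U] by (auto intro: openin_diff closedin_closure_of)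
    then obtain T where T: "open T" "?C = K \<inter> T" by (auto simp: openin_open)
    have "x \<in> ?C" using x V(2)[OF U] fr by auto
    then have "\<forall>\<^sub>F y in at x within (K - V). y \<in> T"
      using T by (intro eventually_at_topological[THEN iffD2]) auto
    moreover have "\<forall>\<^sub>F y in at x within (K - V). y \<in> K - V" by (simp add: eventually_at_filter)
    ultimately show ?thesis
    proof eventually_elim
      case (elim y)
      then have "y \<in> ?C" using T by auto
      moreover have "U \<subseteq> ?X closure_of U" using UK by (intro closure_of_subset) auto
      ultimately show ?case by (auto split: if_splits)
    qed
  qed
  have loc: "\<forall>\<^sub>F y in at x within (K - V). lab y = lab x" if "x \<in> K - V" for x
  proof -
    have "\<forall>\<^sub>F y in at x within (K - V). \<forall>U\<in>\<U>. y \<in> U \<longleftrightarrow> x \<in> U"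
      using fin locU[OF that] by (intro eventually_ball_finite) auto
    then show ?thesis by eventually_elim (auto simp: lab_def)
  qed
  have cont: "continuous_on (K - V) (\<lambda>x. c (lab x))"
    unfolding continuous_on_def
  proof
    fix x assume "x \<in> K - V"
    from loc[OF this] have "\<forall>\<^sub>F y in at x within (K - V). c (lab y) = c (lab x)"
      by eventually_elim simp
    then show "((\<lambda>x. c (lab x)) \<longlongrightarrow> c (lab x)) (at x within K - V)" by (rule tendsto_eventually)
  qed
  \<comment> \<open>One \<open>e\<close> is the oscillation of \<open>f\<close> between
    \<open>x\<close> and the sample point of its atom, which share a member of the cover. The other
    is the shift making the constants distinct.\<close>
  have close: "\<bar>c (lab x) - f x\<bar> \<le> 2 * e" if x: "x \<in> K - V" for x
  proof -
    define z where "z = (SOME z. z \<in> K - V \<and> lab z = lab x)"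
    have z: "z \<in> K - V \<and> lab z = lab x" unfolding z_def by (rule someI[of _ x]) (use x in simp)
    obtain U where "U \<in> \<U>" "x \<in> U" using x cover by blast
    moreover from this have "z \<in> U" using z by (auto simp: lab_def)
    ultimately have "\<bar>f z - f x\<bar> \<le> e" by (intro osc)
    moreover have "\<bar>c (lab x) - f z\<bar> \<le> e" using c(2)[of "lab x"] by (auto simp: lab_def b_def z_def)
    ultimately show ?thesis by linarith
  qed
  have "closedin (top_of_set K) (K - V)"
    using closedin_closed_Int[of "- V" K] V(1) by (simp add: Diff_eq closed_Compl)
  from extend_approximation[OF this f cont _ close] e obtain g where
    "continuous_on K g" "\<forall>x\<in>K - V. g x = c (lab x)" "\<forall>x\<in>K. \<bar>g x - f x\<bar> \<le> 2 * e"
    by auto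
  then show ?thesis using c(1) unfolding lab_def by blast
qed


section \<open>Topological Hausdorff dimension\<close>

text \<open>A basis contains arbitrarily small neighbourhoods of each point, so its members of
  diameter at most \<open>e\<close> still cover \<open>K\<close>. Compactness leaves finitely
  many.\<close>

lemma top_hausdorff_dim_less_cover:
  assumes K: "compact K" "K \<noteq> {}" and dim: "top_hausdorff_dim K < ereal s + 1" and e: "e > 0"
  shows "\<exists>\<U>. finite \<U> \<and> K \<subseteq> \<Union>\<U> \<and>
    (\<forall>U\<in>\<U>. openin (top_of_set K) U \<and> (\<forall>x\<in>U. \<forall>y\<in>U. dist x y \<le> e) \<and>
             hausdorff_dim ((top_of_set K) frontier_of U) < ereal s)"
proof -
  obtain d \<B> where d: "d < ereal s + 1"
    and base: "openin (top_of_set K) = arbitrary union_of (\<lambda>U. U \<in> \<B>)"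
    and fr: "\<And>U. U \<in> \<B> \<Longrightarrow> hausdorff_dim ((top_of_set K) frontier_of U) \<le> d - 1"
    using dim K(2) unfolding top_hausdorff_dim_def by (auto simp: Inf_less_iff)
  have d1: "d - 1 < ereal s" using d by (cases d) (auto simp: one_ereal_def)
  define \<C> where "\<C> = {U \<in> \<B>. \<forall>x\<in>U. \<forall>y\<in>U. dist x y \<le> e}"
  have opB: "openin (top_of_set K) U" if "U \<in> \<B>" for U
    using base that unfolding openin_topology_base_unique by blast
  have "K \<subseteq> \<Union>\<C>"
  proof
    fix x assume x: "x \<in> K"
    have "openin (top_of_set K) (K \<inter> ball x (e/2)) \<and> x \<in> K \<inter> ball x (e/2)"
      using x e by (auto intro: openin_open_Int)
    then obtain V where V: "V \<in> \<B>" "x \<in> V" "V \<subseteq> K \<inter> ball x (e/2)"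
      using base unfolding openin_topology_base_unique by blast
    have "dist y z \<le> e" if "y \<in> V" "z \<in> V" for y z
    proof -
      have "dist x y < e/2" "dist x z < e/2" using that V by auto
      then show ?thesis using dist_triangle[of y z x] by (simp add: dist_commute)
    qed
    then show "x \<in> \<Union>\<C>" using V by (auto simp: \<C>_def)
  qed
  moreover have "\<forall>C\<in>\<C>. openin (top_of_set K) C" using opB by (auto simp: \<C>_def)
  ultimately obtain \<U> where "\<U> \<subseteq> \<C>" "finite \<U>" "K \<subseteq> \<Union>\<U>"
    using K(1) unfolding compact_eq_openin_cover by meson
  then show ?thesis
    using opB le_less_trans[OF fr d1] by (intro exI[of _ \<U>]) (auto simp: \<C>_def)
qed

text \<open>Such neighbourhoods make all open sets with boundary of dimension at most
  \<open>s\<close> a basis. The contrapositive yields a point without small neighbourhoods of this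
  kind.\<close>

lemma top_hausdorff_dim_le:
  assumes "K \<noteq> {}"
    and "\<And>x r. x \<in> K \<Longrightarrow> r > 0 \<Longrightarrow> \<exists>U. openin (top_of_set K) U \<and> x \<in> U \<and> U \<subseteq> ball x r \<and>
           hausdorff_dim ((top_of_set K) frontier_of U) \<le> ereal s"
  shows "top_hausdorff_dim K \<le> ereal s + 1"
proof -
  define \<B> where "\<B> = {U. openin (top_of_set K) U \<and>
    hausdorff_dim ((top_of_set K) frontier_of U) \<le> ereal s}"
  have "openin (top_of_set K) = arbitrary union_of (\<lambda>U. U \<in> \<B>)"
    unfolding openin_topology_base_unique
  proof (intro conjI allI impI)
    fix U x assume U: "openin (top_of_set K) U \<and> x \<in> U"
    then obtain r where r: "r > 0" "ball x r \<inter> K \<subseteq> U"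
      by (meson openin_contains_ball)
    have "x \<in> K" using U openin_imp_subset by blast
    with assms(2) r obtain V where V: "openin (top_of_set K) V" "x \<in> V" "V \<subseteq> ball x r"
      "hausdorff_dim ((top_of_set K) frontier_of V) \<le> ereal s" by blast
    moreover have "V \<subseteq> K" using V(1) by (rule openin_imp_subset)
    ultimately show "\<exists>V. V \<in> \<B> \<and> x \<in> V \<and> V \<subseteq> U" using r by (auto simp: \<B>_def)
  qed (simp add: \<B>_def)
  moreover have "ereal s + 1 - 1 = ereal s" by (simp add: one_ereal_def)
  then have "\<forall>U\<in>\<B>. hausdorff_dim ((top_of_set K) frontier_of U) \<le> ereal s + 1 - 1"
    by (simp add: \<B>_def)
  ultimately show ?thesis
    unfolding top_hausdorff_dim_def using assms(1) by (simp only: if_False) (blast intro!: Inf_lower)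
qed

text \<open>
  A function near \<open>dist x\<^sub>0\<close> with a low-dimensional level set at a height near \<open>r / 2\<close> would have a
  sublevel set that is a neighbourhood of \<open>x\<^sub>0\<close> inside \<open>ball x\<^sub>0 r\<close> with low-dimensional boundary.
\<close>
lemma robust_level_sets:
  fixes K :: "'a::metric_space set"
  assumes "K \<noteq> {}" "ereal s + 1 < top_hausdorff_dim K"
  shows "\<exists>(f0 :: 'a \<Rightarrow> real) r. continuous_on K f0 \<and> r > 0 \<and>
    (\<forall>f y. continuous_on K f \<longrightarrow> (\<forall>x\<in>K. \<bar>f x - f0 x\<bar> \<le> r) \<longrightarrow> \<bar>y\<bar> \<le> r \<longrightarrow>
       ereal s < hausdorff_dim (f -` {y} \<inter> K))"
proof -
  obtain x0 r where x0: "x0 \<in> K" and r: "r > 0"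
    and no: "\<And>U. openin (top_of_set K) U \<Longrightarrow> x0 \<in> U \<Longrightarrow> U \<subseteq> ball x0 r \<Longrightarrow>
      ereal s < hausdorff_dim ((top_of_set K) frontier_of U)"
    using top_hausdorff_dim_le[OF assms(1), of s] assms(2) by (force simp: not_le[symmetric])
  \<comment> \<open>The shift centres the heights at 0: \<open>f0\<close> is \<open>- r / 2\<close>
    at \<open>x0\<close> and at least \<open>r / 2\<close> outside the ball. A tolerance of
    \<open>r / 6\<close> for both \<open>f\<close> and \<open>y\<close> keeps \<open>y\<close>
    strictly between the perturbed values.\<close>
  define f0 where "f0 = (\<lambda>x. dist x0 x - r / 2)"
  have "ereal s < hausdorff_dim (f -` {y} \<inter> K)"
    if f: "continuous_on K f" "\<forall>x\<in>K. \<bar>f x - f0 x\<bar> \<le> r / 6" and y: "\<bar>y\<bar> \<le> r / 6" for f y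
  proof -
    let ?X = "top_of_set K"
    define U where "U = {x \<in> K. f x < y}"
    have "U = K \<inter> f -` {..<y}" by (auto simp: U_def)
    then have "openin ?X U" using continuous_openin_preimage_gen[OF f(1), of "{..<y}"] by simp
    moreover have "x0 \<in> U"
    proof -
      have "\<bar>f x0 - f0 x0\<bar> \<le> r / 6" using f(2) x0 by blast
      moreover have "f0 x0 = - (r / 2)" by (simp add: f0_def)
      ultimately have "f x0 < y" using y r by linarith
      then show ?thesis using x0 by (simp add: U_def)
    qed
    moreover have "U \<subseteq> ball x0 r"
    proof
      fix x assume "x \<in> U"
      then have "x \<in> K" "f x < y" by (auto simp: U_def)
      moreover have "\<bar>f x - f0 x\<bar> \<le> r / 6" using f(2) \<open>x \<in> K\<close> by blast
      moreover have "f0 x = dist x0 x - r / 2" by (simp add: f0_def)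
      ultimately have "dist x0 x < r" using y r by linarith
      then show "x \<in> ball x0 r" by simp
    qed
    ultimately have "ereal s < hausdorff_dim (?X frontier_of U)" by (rule no)
    also have "?X frontier_of U \<subseteq> f -` {y} \<inter> K"
    proof -
      have "closedin ?X (K \<inter> f -` {..y})" using f(1) by (intro continuous_closedin_preimage) auto
      then have "?X closure_of U \<subseteq> K \<inter> f -` {..y}"
        by (intro closure_of_minimal) (auto simp: U_def)
      moreover have "?X frontier_of U = ?X closure_of U - U"
        using \<open>openin ?X U\<close> by (simp add: frontier_of_def interior_of_openin)
      ultimately show ?thesis by (auto simp: U_def)
    qed
    then have "hausdorff_dim (?X frontier_of U) \<le> hausdorff_dim (f -` {y} \<inter> K)"
      by (rule hausdorff_dim_mono)
    finally show ?thesis .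
  qed
  moreover have "continuous_on K f0" unfolding f0_def by (intro continuous_intros)
  moreover have "r / 6 > 0" using r by simp
  ultimately show ?thesis by blast
qed


section \<open>Upper bound\<close>

lemma compact_uniformly_continuous_dist:
  fixes f :: "'a::metric_space \<Rightarrow> real"
  assumes "compact K" "continuous_on K f" "e > 0"
  obtains d where "d > 0" "\<And>x y. x \<in> K \<Longrightarrow> y \<in> K \<Longrightarrow> dist x y \<le> d \<Longrightarrow> \<bar>f x - f y\<bar> \<le> e"
proof -
  obtain d where "d > 0" "\<And>x y. x \<in> K \<Longrightarrow> y \<in> K \<Longrightarrow> dist y x < d \<Longrightarrow> dist (f y) (f x) < e"
    using compact_uniformly_continuous[OF assms(2,1)] assms(3) unfolding uniformly_continuous_on_def by metis
  then show ?thesis using that[of "d/2"] by (force simp: dist_real_def dist_commute abs_minus_commute)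
qed

text \<open>A level set of a function near \<open>g\<close> splits into a part in the neighbourhood
  of the boundaries and a part in a single atom. Each contributes at most \<open>m/2\<close> to the
  \<open>s\<close>-sum.\<close>

lemma dense_small_level_sets:
  fixes K :: "'a::metric_space set" and f :: "'a \<Rightarrow> real"
  assumes K: "compact K" "K \<noteq> {}" and s: "s > 0" "top_hausdorff_dim K < ereal s + 1"
    and f: "continuous_on K f" and e: "e > 0" and m: "m > 0"
  shows "\<exists>g r. continuous_on K g \<and> (\<forall>x\<in>K. \<bar>g x - f x\<bar> \<le> e) \<and> r > 0 \<and>
    (\<forall>h. (\<forall>x\<in>K. \<bar>h x - g x\<bar> \<le> r) \<longrightarrow>
       (\<forall>y. \<exists>W\<in>fine_covers m (h -` {y} \<inter> K). (\<Sum>i. diam_powr s (W i)) \<le> ennreal m))"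
proof -
  obtain d1 where d1: "d1 > 0" "\<And>x y. x \<in> K \<Longrightarrow> y \<in> K \<Longrightarrow> dist x y \<le> d1 \<Longrightarrow> \<bar>f x - f y\<bar> \<le> e/2"
    using compact_uniformly_continuous_dist[OF K(1) f, of "e/2"] e by auto
  \<comment> \<open>The three bounds control, in turn, the oscillation of \<open>f\<close>, the mesh
    of the final cover, and the \<open>s\<close>-th power of the diameter of the single
    atom.\<close>
  define d where "d = min d1 (min m ((m/2) powr (1/s)))"
  have d: "d > 0" "d \<le> d1" "d \<le> m" using d1 m by (auto simp: d_def)
  have "d powr s \<le> ((m/2) powr (1/s)) powr s"
    using d(1) s by (intro powr_mono2) (auto simp: d_def)
  then have ds: "d powr s \<le> m/2" using s m by (simp add: powr_powr)
  obtain \<U> where fin: "finite \<U>" and cover: "K \<subseteq> \<Union>\<U>"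
    and \<U>: "\<forall>U\<in>\<U>. openin (top_of_set K) U \<and> (\<forall>x\<in>U. \<forall>y\<in>U. dist x y \<le> d) \<and>
      hausdorff_dim ((top_of_set K) frontier_of U) < ereal s"
    using top_hausdorff_dim_less_cover[OF K s(2) d(1)] by (elim exE conjE)
  have op: "openin (top_of_set K) U" if "U \<in> \<U>" for U using \<U> that by blast
  have small: "dist x y \<le> d" if "U \<in> \<U>" "x \<in> U" "y \<in> U" for U x y using \<U> that by blast
  have dim: "hausdorff_dim ((top_of_set K) frontier_of U) < ereal s" if "U \<in> \<U>" for U
    using \<U> that by blast
  let ?F = "\<Union>U\<in>\<U>. (top_of_set K) frontier_of U"
  have "hausdorff_measure s ?F = 0"
    using fin dim by (intro hausdorff_null_Union) (auto intro: hausdorff_dim_less_imp_null countable_finite)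
  then obtain V where V: "V \<in> fine_covers (m/2) ?F" "\<And>i. open (V i)"
    "(\<Sum>i. diam_powr s (V i)) \<le> ennreal (m/2)"
    using ex_open_cover_hausdorff_null[OF s(1), of ?F "m/2"] m by auto
  let ?V = "\<Union>i. V i"
  have FV: "?F \<subseteq> ?V" using V(1) by (simp add: fine_covers_def)
  have sub: "U \<subseteq> K" if "U \<in> \<U>" for U using op[OF that] by (rule openin_imp_subset)
  have "\<exists>g c. continuous_on K g \<and> (\<forall>x\<in>K. \<bar>g x - f x\<bar> \<le> 2 * (e/2)) \<and> inj_on c (Pow \<U>) \<and>
    (\<forall>x\<in>K - ?V. g x = c {U \<in> \<U>. x \<in> U})"
  proof (rule approximation_constant_on_atoms[OF fin cover op _ _ f])
    show "open ?V" using V(2) by blast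
    show "(top_of_set K) frontier_of U \<subseteq> ?V" if "U \<in> \<U>" for U using FV that by blast
    show "\<bar>f x - f y\<bar> \<le> e/2" if "U \<in> \<U>" "x \<in> U" "y \<in> U" for U x y
      using that sub small[OF that] d(2) by (intro d1(2)) auto
  qed (use e in auto)
  then obtain g c where g: "continuous_on K g" "\<And>x. x \<in> K \<Longrightarrow> \<bar>g x - f x\<bar> \<le> e"
    and c: "inj_on c (Pow \<U>)" and gc: "\<And>x. x \<in> K - ?V \<Longrightarrow> g x = c {U \<in> \<U>. x \<in> U}"
    by auto
  have "finite (c ` Pow \<U>)" using fin by simp
  from finite_separated[OF this] obtain r where r: "r > 0"
    and sep: "\<forall>a\<in>c ` Pow \<U>. \<forall>b\<in>c ` Pow \<U>. a \<noteq> b \<longrightarrow> 2 * r < dist a b" by blast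
  have "\<exists>W\<in>fine_covers m (h -` {y} \<inter> K). (\<Sum>i. diam_powr s (W i)) \<le> ennreal m"
    if h: "\<forall>x\<in>K. \<bar>h x - g x\<bar> \<le> r" for h y
  proof -
    define C where "C = (h -` {y} \<inter> K) - ?V"
    have "dist x z \<le> d" if xz: "x \<in> C" "z \<in> C" for x z
    proof -
      have "h x = y" "h z = y" "x \<in> K" "z \<in> K" using xz by (auto simp: C_def)
      moreover from this have "\<bar>h x - g x\<bar> \<le> r" "\<bar>h z - g z\<bar> \<le> r" using h by auto
      \<comment> \<open>The constants are more than \<open>2 * r\<close> apart, so
        \<open>g x\<close> and \<open>g z\<close> coincide. Injectivity of \<open>c\<close> then
        puts both points into the same atom.\<close>
      ultimately have "\<bar>g x - g z\<bar> \<le> 2 * r" by linarith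
      moreover have "g x \<in> c ` Pow \<U>" "g z \<in> c ` Pow \<U>" using gc xz by (auto simp: C_def)
      then have "g x \<noteq> g z \<Longrightarrow> 2 * r < dist (g x) (g z)" using sep by blast
      ultimately have "g x = g z" by (force simp: dist_real_def)
      then have "{U \<in> \<U>. x \<in> U} = {U \<in> \<U>. z \<in> U}"
        using gc xz by (intro inj_onD[OF c]) (auto simp: C_def)
      moreover obtain U where "U \<in> \<U>" "x \<in> U" using cover xz by (auto simp: C_def)
      ultimately show ?thesis by (intro small[of U]) auto
    qed
    then have C: "bounded C" "diameter C \<le> d"
      using d(1) by (auto intro: bounded_dist_le diameter_le_dist)
    have "(\<Sum>i. diam_powr s (case_nat C V i)) \<le> ennreal (m/2) + ennreal (m/2)"
      unfolding suminf_diam_powr_case_nat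
      using order_trans[OF diam_powr_le[OF s(1) C] ennreal_leI[OF ds]] V(3) by (rule add_mono)
    also have "\<dots> = ennreal m" using m by (simp flip: ennreal_plus)
    finally have "(\<Sum>i. diam_powr s (case_nat C V i)) \<le> ennreal m" .
    moreover have "V \<in> fine_covers (m/2) ?V" using V(1) by (simp add: fine_covers_def)
    then have "V \<in> fine_covers m ?V" using fine_covers_mono[of "m/2" m ?V ?V] m by auto
    then have "case_nat C V \<in> fine_covers m (C \<union> ?V)"
      using C d(3) by (intro fine_covers_case_nat) auto
    then have "case_nat C V \<in> fine_covers m (h -` {y} \<inter> K)"
      using fine_covers_mono[of m m "h -` {y} \<inter> K" "C \<union> ?V"] by (auto simp: C_def)
    ultimately show ?thesis by blast
  qed
  then show ?thesis using g r by blast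
qed

text \<open>With \<open>s = 0\<close> the boundaries have negative dimension and are empty. Hence
  \<open>V\<close> can be taken empty, \<open>g\<close> has finite range, and it omits a value of
  \<open>{p..q}\<close> stably.\<close>

lemma dense_image_not_interval:
  fixes K :: "'a::metric_space set" and f :: "'a \<Rightarrow> real"
  assumes K: "compact K" "K \<noteq> {}" and dim: "top_hausdorff_dim K < 1" and "p < q"
    and f: "continuous_on K f" and e: "e > 0"
  shows "\<exists>g r. continuous_on K g \<and> (\<forall>x\<in>K. \<bar>g x - f x\<bar> \<le> e) \<and> r > 0 \<and>
    (\<forall>h. (\<forall>x\<in>K. \<bar>h x - g x\<bar> \<le> r) \<longrightarrow> \<not> {p..q} \<subseteq> h ` K)"
proof -
  obtain d where d: "d > 0" "\<And>x y. x \<in> K \<Longrightarrow> y \<in> K \<Longrightarrow> dist x y \<le> d \<Longrightarrow> \<bar>f x - f y\<bar> \<le> e/2"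
    using compact_uniformly_continuous_dist[OF K(1) f, of "e/2"] e by auto
  have "top_hausdorff_dim K < ereal 0 + 1" using dim by (simp add: one_ereal_def)
  obtain \<U> where fin: "finite \<U>" and cover: "K \<subseteq> \<Union>\<U>"
    and \<U>: "\<forall>U\<in>\<U>. openin (top_of_set K) U \<and> (\<forall>x\<in>U. \<forall>y\<in>U. dist x y \<le> d) \<and>
      hausdorff_dim ((top_of_set K) frontier_of U) < ereal 0"
    using top_hausdorff_dim_less_cover[OF K \<open>top_hausdorff_dim K < ereal 0 + 1\<close> d(1)] by (elim exE conjE)
  have op: "openin (top_of_set K) U" if "U \<in> \<U>" for U using \<U> that by blast
  have small: "dist x y \<le> d" if "U \<in> \<U>" "x \<in> U" "y \<in> U" for U x y using \<U> that by blast
  have dim0: "hausdorff_dim ((top_of_set K) frontier_of U) < ereal 0" if "U \<in> \<U>" for U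
    using \<U> that by blast
  have sub: "U \<subseteq> K" if "U \<in> \<U>" for U using op[OF that] by (rule openin_imp_subset)
  have "\<exists>g c. continuous_on K g \<and> (\<forall>x\<in>K. \<bar>g x - f x\<bar> \<le> 2 * (e/2)) \<and> inj_on c (Pow \<U>) \<and>
    (\<forall>x\<in>K - {}. g x = c {U \<in> \<U>. x \<in> U})"
  proof (rule approximation_constant_on_atoms[OF fin cover op _ _ f])
    show "(top_of_set K) frontier_of U \<subseteq> {}" if "U \<in> \<U>" for U
      using dim0[OF that] hausdorff_dim_nonneg[of "(top_of_set K) frontier_of U"]
      by (metis ereal_eq_0(2) leD subsetI empty_iff)
    show "\<bar>f x - f y\<bar> \<le> e/2" if "U \<in> \<U>" "x \<in> U" "y \<in> U" for U x y
      using that sub small[OF that] by (intro d(2)) auto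
  qed (use e in auto)
  then obtain g c where g: "continuous_on K g" "\<And>x. x \<in> K \<Longrightarrow> \<bar>g x - f x\<bar> \<le> e"
    and gc: "\<And>x. x \<in> K \<Longrightarrow> g x = c {U \<in> \<U>. x \<in> U}"
    by auto
  have "g ` K \<subseteq> c ` Pow \<U>" using gc by auto
  then have "finite (g ` K)" by (rule finite_subset) (use fin in simp)
  then obtain y where y: "y \<in> {p..q}" "y \<notin> g ` K"
    using \<open>p < q\<close> by (metis finite_subset infinite_Icc subsetI)
  from not_in_image_open[OF K(1) g(1) y(2)] y(1) g show ?thesis by blast
qed


section \<open>Lower bound\<close>

lemma dense_large_level_sets:
  fixes K :: "'a::metric_space set" and f :: "'a \<Rightarrow> real"
  assumes K: "compact K" "K \<noteq> {}" "weakly_self_similar K"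
    and s: "ereal s + 1 < top_hausdorff_dim K"
    and f: "continuous_on K f" and e: "e > 0"
  shows "\<exists>g r. continuous_on K g \<and> (\<forall>x\<in>K. \<bar>g x - f x\<bar> \<le> e) \<and> r > 0 \<and>
    (\<forall>h. continuous_on K h \<longrightarrow> (\<forall>x\<in>K. \<bar>h x - g x\<bar> \<le> r) \<longrightarrow> {p..q} \<subseteq> h ` K \<longrightarrow>
       (\<forall>y\<in>{p..q}. ereal s < hausdorff_dim (h -` {y} \<inter> K)))"
proof (cases "{p..q} \<subseteq> f ` K")
  case False
  \<comment> \<open>An omitted value stays omitted nearby, so \<open>g = f\<close> works and the
    claim about level sets is vacuous.\<close>
  then obtain y where y: "y \<in> {p..q}" "y \<notin> f ` K" by blast
  from not_in_image_open[OF K(1) f y(2)] obtain r where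
    r: "r > 0" "\<forall>h. (\<forall>x\<in>K. \<bar>h x - f x\<bar> \<le> r) \<longrightarrow> y \<notin> h ` K" by blast
  then have "\<not> {p..q} \<subseteq> h ` K" if "\<forall>x\<in>K. \<bar>h x - f x\<bar> \<le> r" for h using that y(1) by blast
  then show ?thesis using f e r(1) by (intro exI[of _ f] exI[of _ r]) auto
next
  case True
  obtain f0 :: "'a \<Rightarrow> real" and r0 where f0: "continuous_on K f0" and r0: "r0 > 0"
    and rob: "\<And>f y. continuous_on K f \<Longrightarrow> (\<forall>x\<in>K. \<bar>f x - f0 x\<bar> \<le> r0) \<Longrightarrow> \<bar>y\<bar> \<le> r0 \<Longrightarrow>
       ereal s < hausdorff_dim (f -` {y} \<inter> K)"
    using robust_level_sets[OF K(2) s] by blast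
  obtain B where B: "B > 0" "\<And>x. x \<in> K \<Longrightarrow> \<bar>f0 x\<bar> \<le> B"
    using compact_imp_bounded[OF compact_continuous_image[OF f0 K(1)]]
    by (auto simp: bounded_pos)
  \<comment> \<open>The scale makes \<open>a * f0\<close> at most \<open>e/2\<close> in absolute
    value, half of the permitted error.\<close>
  define a where "a = e / (2 * B)"
  have a: "a > 0" "a * B = e/2" using e B by (auto simp: a_def)
  \<comment> \<open>Robustness of \<open>f0\<close> passes to \<open>c + a * f0\<close> through the
    substitution \<open>(k x - c) / a\<close>, with tolerance and range of heights both scaled to
    \<open>a * r0\<close>.\<close>
  have rob': "ereal s < hausdorff_dim (k -` {y} \<inter> K)"
    if k: "continuous_on K k" "\<And>x. x \<in> K \<Longrightarrow> \<bar>k x - (c + a * f0 x)\<bar> \<le> a * r0"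
      and y: "\<bar>y - c\<bar> \<le> a * r0" for k c y
  proof -
    have scale: "\<bar>t\<bar> \<le> a * r0 \<Longrightarrow> \<bar>t / a\<bar> \<le> r0" for t
      using a(1) by (simp add: abs_divide pos_divide_le_eq mult.commute)
    have "\<bar>(k x - c) / a - f0 x\<bar> \<le> r0" if "x \<in> K" for x
    proof -
      have "(k x - c) / a - f0 x = (k x - (c + a * f0 x)) / a" using a(1) by (simp add: field_simps)
      then show ?thesis using scale k(2)[OF that] by metis
    qed
    then have "ereal s < hausdorff_dim ((\<lambda>x. (k x - c) / a) -` {(y - c) / a} \<inter> K)"
      using scale[OF y] k(1) a(1) by (intro rob) (auto intro!: continuous_intros)
    moreover have "(\<lambda>x. (k x - c) / a) -` {(y - c) / a} = k -` {y}" using a(1) by auto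
    ultimately show ?thesis by simp
  qed
  have "{p..q} \<subseteq> (\<Union>y\<in>{p..q}. ball y (a * r0))" using a r0 by auto
  \<comment> \<open>One copy controls the heights within \<open>a * r0\<close> of its centre, so
    copies centred at finitely many heights \<open>Y\<close> suffice for
    \<open>{p..q}\<close>.\<close>
  then obtain Y where Y: "Y \<subseteq> {p..q}" "finite Y" "{p..q} \<subseteq> (\<Union>y\<in>Y. ball y (a * r0))"
    using compactE_image[OF compact_Icc, of "{p..q}" "\<lambda>y. ball y (a * r0)" p q] by auto
  have "\<forall>y\<in>Y. \<exists>x\<in>K. f x = y" using Y(1) True by blast
  then obtain x where x: "\<And>y. y \<in> Y \<Longrightarrow> x y \<in> K" "\<And>y. y \<in> Y \<Longrightarrow> f (x y) = y" by metis
  obtain d1 where d1: "d1 > 0" "\<And>x y. x \<in> K \<Longrightarrow> y \<in> K \<Longrightarrow> dist x y \<le> d1 \<Longrightarrow> \<bar>f x - f y\<bar> \<le> e/2"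
    using compact_uniformly_continuous_dist[OF K(1) f, of "e/2"] e by auto
  have "finite (x ` Y)" using Y(2) by simp
  from finite_separated[OF this] obtain d2 where d2: "d2 > 0"
    "\<forall>u\<in>x ` Y. \<forall>v\<in>x ` Y. u \<noteq> v \<longrightarrow> 2 * d2 < dist u v" by blast
  \<comment> \<open>The bound \<open>d1\<close> keeps \<open>f\<close> within \<open>e/2\<close> of
    \<open>y\<close> on the copy at \<open>x y\<close>, and \<open>d2\<close> makes the copies
    disjoint.\<close>
  define d where "d = min d1 d2"
  have d: "d > 0" "d \<le> d1" "d \<le> d2" using d1 d2 by (auto simp: d_def)
  have "\<forall>y\<in>Y. \<exists>K' \<phi>. compact K' \<and> K' \<subseteq> K \<inter> cball (x y) d \<and> bi_lipschitz_betw \<phi> K' K"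
    using K(3) x(1) d(1) unfolding weakly_self_similar_def by blast
  then obtain K' \<phi> where K': "\<And>y. y \<in> Y \<Longrightarrow> compact (K' y)"
    "\<And>y. y \<in> Y \<Longrightarrow> K' y \<subseteq> K \<inter> cball (x y) d"
    and bl: "\<And>y. y \<in> Y \<Longrightarrow> bi_lipschitz_betw (\<phi> y) (K' y) K" by metis
  have bij: "bij_betw (\<phi> y) (K' y) K" if "y \<in> Y" for y
    using bl[OF that] by (simp add: bi_lipschitz_betw_def)
  have disj: "y = z" if "y \<in> Y" "z \<in> Y" "w \<in> K' y" "w \<in> K' z" for y z w
  proof (rule ccontr)
    assume "y \<noteq> z"
    \<comment> \<open>Distinct heights have distinct base points because
      \<open>f (x y) = y\<close>.\<close>
    then have "x y \<noteq> x z" using x that by metis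
    then have "2 * d2 < dist (x y) (x z)" using d2(2) that by blast
    moreover have "dist (x y) w \<le> d" "dist (x z) w \<le> d"
      using K'(2)[OF that(1)] K'(2)[OF that(2)] that by auto
    ultimately show False using d(3) dist_triangle2[of "x y" "x z" w] by linarith
  qed
  define S where "S = (\<Union>y\<in>Y. K' y)"
  define idx where "idx = (\<lambda>w. THE y. y \<in> Y \<and> w \<in> K' y)"
  have idx: "idx w = y" if "y \<in> Y" "w \<in> K' y" for y w
    unfolding idx_def using that disj by (intro the_equality) auto
  \<comment> \<open>On the copy \<open>K' y\<close> this is \<open>y + a * f0\<close> pulled back
    along \<open>\<phi> y\<close>. Disjointness makes \<open>idx\<close> pick out that
    \<open>y\<close>.\<close>
  define u where "u = (\<lambda>w. idx w + a * f0 (\<phi> (idx w) w))"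
  have u: "u w = y + a * f0 (\<phi> y w)" if "y \<in> Y" "w \<in> K' y" for y w
    using idx[OF that] by (simp add: u_def)
  have "continuous_on S u"
    unfolding S_def
  proof (rule continuous_on_closed_Union)
    show "finite Y" by fact
    show "closed (K' y)" if "y \<in> Y" for y using K'(1)[OF that] by (rule compact_imp_closed)
    show "continuous_on (K' y) u" if y: "y \<in> Y" for y
    proof -
      have "continuous_on (K' y) (\<phi> y)"
        using bl[OF y] by (auto simp: bi_lipschitz_betw_def intro: lipschitz_on_continuous_on)
      then have "continuous_on (K' y) (\<lambda>w. f0 (\<phi> y w))"
        using bij[OF y] by (intro continuous_on_compose2[OF f0]) (auto simp: bij_betw_def)
      then have "continuous_on (K' y) (\<lambda>w. y + a * f0 (\<phi> y w))" by (intro continuous_intros)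
      then show ?thesis using u[OF y] by (simp cong: continuous_on_cong)
    qed
  qed
  moreover have "closedin (top_of_set K) S"
  proof -
    have "closed S" unfolding S_def using Y(2) K'(1) by (intro closed_UN) (auto intro: compact_imp_closed)
    moreover have "S \<subseteq> K" using K'(2) by (auto simp: S_def)
    ultimately show ?thesis by (rule closed_subset[rotated])
  qed
  moreover have "\<bar>u w - f w\<bar> \<le> e" if w: "w \<in> S" for w
  proof -
    obtain y where y: "y \<in> Y" "w \<in> K' y" using w by (auto simp: S_def)
    have "\<bar>a * f0 (\<phi> y w)\<bar> \<le> a * B"
      using B(2)[of "\<phi> y w"] bij[OF y(1)] y a(1) by (auto simp: abs_mult bij_betw_def)
    moreover have "\<bar>f (x y) - f w\<bar> \<le> e/2"
      using K'(2) y x(1) d(2) by (intro d1(2)) force+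
    ultimately show ?thesis using u[OF y] x(2)[OF y(1)] a(2) by linarith
  qed
  ultimately obtain g where g: "continuous_on K g" "\<And>w. w \<in> S \<Longrightarrow> g w = u w"
    "\<And>w. w \<in> K \<Longrightarrow> \<bar>g w - f w\<bar> \<le> e"
    using extend_approximation[OF _ f, of S u e] e by auto
  have "ereal s < hausdorff_dim (h -` {y} \<inter> K)"
    if h: "continuous_on K h" "\<forall>x\<in>K. \<bar>h x - g x\<bar> \<le> a * r0" and y: "y \<in> {p..q}" for h y
  proof -
    obtain z where z: "z \<in> Y" "\<bar>y - z\<bar> \<le> a * r0"
      using Y(3) y by (force simp: dist_real_def abs_minus_commute)
    \<comment> \<open>Composing with the inverse moves \<open>h\<close> from the copy to all of
      \<open>K\<close>, where it is close to \<open>z + a * f0\<close> and \<open>rob'\<close>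
      applies. The Lipschitz map \<open>\<phi> z\<close> then shows that the level set inside the
      copy has at least the same dimension.\<close>
    let ?\<psi> = "inv_into (K' z) (\<phi> z)"
    have im: "\<phi> z ` K' z = K" using bij[OF z(1)] by (simp add: bij_betw_def)
    have \<psi>: "?\<psi> v \<in> K' z" "\<phi> z (?\<psi> v) = v" if "v \<in> K" for v
      using that im by (auto intro: inv_into_into f_inv_into_f)
    have K'K: "K' z \<subseteq> K" using K'(2)[OF z(1)] by auto
    have "continuous_on K ?\<psi>"
      using bl[OF z(1)] by (auto simp: bi_lipschitz_betw_def intro: lipschitz_on_continuous_on)
    then have "continuous_on K (\<lambda>v. h (?\<psi> v))"
      using \<psi> K'K by (intro continuous_on_compose2[OF h(1)]) auto
    moreover have "\<bar>h (?\<psi> v) - (z + a * f0 v)\<bar> \<le> a * r0" if v: "v \<in> K" for v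
    proof -
      have "?\<psi> v \<in> S" using \<psi>(1)[OF v] z(1) by (auto simp: S_def)
      then have "g (?\<psi> v) = z + a * f0 v"
        using g(2) u[OF z(1) \<psi>(1)[OF v]] \<psi>(2)[OF v] by simp
      then show ?thesis using h(2) \<psi>(1)[OF v] K'K by force
    qed
    ultimately have "ereal s < hausdorff_dim ((\<lambda>v. h (?\<psi> v)) -` {y} \<inter> K)"
      using z(2) by (rule rob')
    also have "\<dots> \<le> hausdorff_dim (\<phi> z ` (h -` {y} \<inter> K' z))"
      using \<psi> by (intro hausdorff_dim_mono) (force intro: rev_image_eqI)
    also obtain L where "L-lipschitz_on (K' z) (\<phi> z)"
      using bl[OF z(1)] by (auto simp: bi_lipschitz_betw_def)
    then have "hausdorff_dim (\<phi> z ` (h -` {y} \<inter> K' z)) \<le> hausdorff_dim (h -` {y} \<inter> K' z)"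
      by (intro hausdorff_dim_lipschitz_image[of L]) (auto intro: lipschitz_on_subset)
    also have "\<dots> \<le> hausdorff_dim (h -` {y} \<inter> K)"
      using K'K by (intro hausdorff_dim_mono) auto
    finally show ?thesis .
  qed
  then show ?thesis using g a r0 by (intro exI[of _ g] exI[of _ "a * r0"]) auto
qed


section \<open>The dimension of level sets\<close>

text \<open>Testing only rational thresholds keeps the family of generic conditions
  countable.\<close>

lemma ereal_le_by_rats:
  fixes a b :: ereal
  assumes "\<And>s. s \<in> \<rat> \<Longrightarrow> b < ereal s \<Longrightarrow> a \<le> ereal s"
  shows "a \<le> b"
proof (rule ccontr)
  assume "\<not> a \<le> b"
  then obtain r where "b < ereal (real_of_rat r)" "ereal (real_of_rat r) < a"
    using ereal_dense3[of b a] by (meson not_le)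
  then show False using assms[of "real_of_rat r"] by auto
qed

theorem theorem3p6:
  fixes K :: "'a::metric_space set"
  assumes "compact K"
    and "weakly_self_similar K"
  shows "generic_in_C K (\<lambda>f. \<forall>y\<in>interior (f ` K).
           hausdorff_dim (f -` {y} \<inter> K) = top_hausdorff_dim K - 1)"
proof (cases "K = {}")
  \<comment> \<open>Images of the empty space have empty interior, so an empty family of conditions
    suffices.\<close>
  case True
  show ?thesis
    by (rule generic_in_C_I[where I = "{} :: nat set" and Q = "\<lambda>_ _. True"]) (simp_all add: True)
next
  case False
  note K = assms(1) False
  let ?d = "top_hausdorff_dim K"
  define A where "A = (\<lambda>(s, n::nat) (h :: 'a \<Rightarrow> real). \<forall>y. \<exists>W\<in>fine_covers (1 / real (Suc n)) (h -` {y} \<inter> K).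
    (\<Sum>i. diam_powr s (W i)) \<le> ennreal (1 / real (Suc n)))"
  define B where "B = (\<lambda>(p, q) (h :: 'a \<Rightarrow> real). \<not> {p..q} \<subseteq> h ` K)"
  define C where "C = (\<lambda>(s, p, q) (h :: 'a \<Rightarrow> real). {p..q} \<subseteq> h ` K \<longrightarrow>
    (\<forall>y\<in>{p..q}. ereal s < hausdorff_dim (h -` {y} \<inter> K)))"
  \<comment> \<open>The index sets admit just those rational parameters to which the three density
    lemmas apply: small level sets for \<open>A\<close>, images without intervals for
    \<open>B\<close>, large level sets for \<open>C\<close>.\<close>
  define IA where "IA = {(s, n::nat). s \<in> \<rat> \<and> 0 < s \<and> ?d < ereal s + 1}"
  define IB where "IB = {(p, q :: real). p \<in> \<rat> \<and> q \<in> \<rat> \<and> p < q \<and> ?d < 1}"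
  define IC where "IC = {(s, p :: real, q :: real). s \<in> \<rat> \<and> p \<in> \<rat> \<and> q \<in> \<rat> \<and> ereal s + 1 < ?d}"
  show ?thesis
  \<comment> \<open>The conditions serve as their own indices, which joins three families with
    different parameter types.\<close>
  proof (rule generic_in_C_I[OF K(1), where I = "A ` IA \<union> B ` IB \<union> C ` IC" and Q = "\<lambda>i. i"])
    have "countable IA"
      by (rule countable_subset[of _ "\<rat> \<times> UNIV"]) (auto simp: IA_def countable_rat)
    moreover have "countable IB"
      by (rule countable_subset[of _ "\<rat> \<times> \<rat>"]) (auto simp: IB_def countable_rat)
    moreover have "countable IC"
      by (rule countable_subset[of _ "\<rat> \<times> \<rat> \<times> \<rat>"]) (auto simp: IC_def countable_rat)
    ultimately show "countable (A ` IA \<union> B ` IB \<union> C ` IC)" by simp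
  next
    fix Q :: "('a \<Rightarrow> real) \<Rightarrow> bool" and f :: "'a \<Rightarrow> real" and e :: real
    assume "Q \<in> A ` IA \<union> B ` IB \<union> C ` IC" and f: "continuous_on K f" and e: "e > 0"
    then consider s n where "Q = A (s, n)" "0 < s" "?d < ereal s + 1"
      | p q where "Q = B (p, q)" "p < q" "?d < 1"
      | s p q where "Q = C (s, p, q)" "ereal s + 1 < ?d"
      by (auto simp: IA_def IB_def IC_def)
    then show "\<exists>g r. continuous_on K g \<and> (\<forall>x\<in>K. \<bar>g x - f x\<bar> \<le> e) \<and> r > 0 \<and>
        (\<forall>h. continuous_on K h \<longrightarrow> (\<forall>x\<in>K. \<bar>h x - g x\<bar> \<le> r) \<longrightarrow> Q h)"
    proof cases
      case 1
      have "1 / real (Suc n) > 0" by simp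
      from dense_small_level_sets[OF K 1(2,3) f e this] show ?thesis
        unfolding 1(1) A_def prod.case by blast
    next
      case 2
      then show ?thesis
        using dense_image_not_interval[OF K 2(3,2) f e] unfolding 2(1) B_def prod.case by blast
    next
      case 3
      then show ?thesis
        using dense_large_level_sets[OF K assms(2) 3(2) f e, of p q] unfolding 3(1) C_def prod.case by blast
    qed
  next
    fix h :: "'a \<Rightarrow> real"
    assume h: "continuous_on K h" and Q: "\<forall>Q\<in>A ` IA \<union> B ` IB \<union> C ` IC. Q h"
    show "\<forall>y\<in>interior (h ` K). hausdorff_dim (h -` {y} \<inter> K) = ?d - 1"
    proof
      fix y assume y: "y \<in> interior (h ` K)"
      let ?L = "h -` {y} \<inter> K"
      have L: "?L \<noteq> {}" using y interior_subset by blast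
      obtain r where r: "r > 0" "cball y r \<subseteq> h ` K" using y by (auto simp: mem_interior_cball)
      obtain p q where pq: "p \<in> \<rat>" "q \<in> \<rat>" "y - r < p" "p < y" "y < q" "q < y + r"
        using Rats_dense_in_real[of "y - r" y] Rats_dense_in_real[of y "y + r"] r(1) by auto
      have "{p..q} \<subseteq> cball y r" using pq by (auto simp: dist_real_def)
      then have sub: "{p..q} \<subseteq> h ` K" using r(2) by blast
      \<comment> \<open>If the dimension were below 1, \<open>B\<close> would forbid the interval
        \<open>{p..q}\<close> in the image. The bound also forces \<open>0 < s\<close> in the upper
        estimate, as \<open>IA\<close> demands.\<close>
      have d1: "1 \<le> ?d"
      proof (rule ccontr)
        assume "\<not> 1 \<le> ?d"
        then have "(p, q) \<in> IB" using pq by (simp add: IB_def not_le)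
        then have "B (p, q) h" using Q by blast
        then show False using sub by (simp add: B_def)
      qed
      show "hausdorff_dim ?L = ?d - 1"
      proof (rule antisym)
        show "hausdorff_dim ?L \<le> ?d - 1"
        proof (rule ereal_le_by_rats)
          fix s :: real assume s: "s \<in> \<rat>" "?d - 1 < ereal s"
          have ds: "?d < ereal s + 1" using s(2) by (cases ?d) (auto simp: one_ereal_def)
          have "ereal 1 < ereal (s + 1)" using le_less_trans[OF d1 ds] by (simp add: one_ereal_def)
          then have "0 < s" by simp
          have "hausdorff_measure s ?L = 0"
            unfolding hausdorff_measure_eq_0_iff
          proof (intro allI impI)
            fix e :: real assume "e > 0"
            then obtain n where n: "1 / real (Suc n) < e" using nat_approx_posE by blast
            have "(s, n) \<in> IA" using s ds \<open>0 < s\<close> by (simp add: IA_def)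
            then have "A (s, n) h" using Q by blast
            then obtain W where W: "W \<in> fine_covers (1 / real (Suc n)) ?L"
              "(\<Sum>i. diam_powr s (W i)) \<le> ennreal (1 / real (Suc n))" unfolding A_def by auto
            have "W \<in> fine_covers e ?L"
              using W(1) fine_covers_mono[of "1 / real (Suc n)" e ?L ?L] n by auto
            moreover have "(\<Sum>i. diam_powr s (W i)) \<le> ennreal e"
              using W(2) ennreal_leI[of "1 / real (Suc n)" e] n by (meson less_imp_le order_trans)
            ultimately show "\<exists>U\<in>fine_covers e ?L. (\<Sum>i. diam_powr s (U i)) \<le> ennreal e" by blast
          qed
          with \<open>0 < s\<close> show "hausdorff_dim ?L \<le> ereal s" by (intro hausdorff_dim_le_null) auto
        qed
        \<comment> \<open>A rational \<open>s\<close> strictly between the two sides would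
          contradict \<open>C\<close> on \<open>{p..q}\<close>, an interval containing
          \<open>y\<close>.\<close>
        show "?d - 1 \<le> hausdorff_dim ?L"
        proof (rule ereal_le_by_rats, rule ccontr)
          fix s :: real assume s: "s \<in> \<rat>" "hausdorff_dim ?L < ereal s" "\<not> ?d - 1 \<le> ereal s"
          then have "ereal s + 1 < ?d" by (cases ?d) (auto simp: one_ereal_def)
          then have "(s, p, q) \<in> IC" using s pq by (simp add: IC_def)
          then have "C (s, p, q) h" using Q by blast
          then have "ereal s < hausdorff_dim ?L" using sub pq by (simp add: C_def)
          then show False using s(2) by simp
        qed
      qed
    qed
  qed
qed

end
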